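(* Let $a,b,c,d$ be real numbers with $a+b=c+d$, let $n\ge 1$, and let $k_1,\dots,k_n$ be arbitrary real numbers. Define finite sequences $x^{(m)}=(x^{(m)}_1,\dots,x^{(m)}_{2^m})$ and $y^{(m)}=(y^{(m)}_1,\dots,y^{(m)}_{2^m})$ for $1\le m\le n$ recursively by $x^{(1)}=(a+k_1,\;b+k_1)$, $y^{(1)}=(c+k_1,\;d+k_1)$, and for $2\le m\le n$ and $1\le j\le 2^{m-1}$: $x^{(m)}_j=x^{(m-1)}_j$, $x^{(m)}_{2^{m-1}+j}=y^{(m-1)}_j+k_m$, $y^{(m)}_j=y^{(m-1)}_j$, $y^{(m)}_{2^{m-1}+j}=x^{(m-1)}_j+k_m$. Write $x_i=x^{(n)}_i$ and $y_i=y^{(n)}_i$ for $1\le i\le 2^n$. Then for every $p$ with $1\le p\le n$: (i) $\displaystyle\sum_{i=1}^{2^n}x_i^p=\sum_{i=1}^{2^n}y_i^p$, and (ii) $\displaystyle\sum_{i=1}^{2^p}x_i^p=\sum_{i=1}^{2^p}y_i^p$.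
   Context: All numbers are real. Note that by construction the first $2^m$ entries of $x^{(n)}$ (resp. $y^{(n)}$) coincide with $x^{(m)}$ (resp. $y^{(m)}$) for $m\le n$. *)

theory Defs
  imports Complex_Main
begin

text \<open>
  The entries of the sequences are indexed from \<open>1\<close>: \<open>xseq a b c d k m i\<close> is the \<open>i\<close>-th entry of
  \<open>x\<^sup>(\<^sup>m\<^sup>)\<close>, meaningful for \<open>1 \<le> m\<close> and \<open>1 \<le> i \<le> 2 ^ m\<close>. Values outside this range are irrelevant,
  and the level \<open>m = 0\<close> is a dummy. Only \<open>k 1, \<dots>, k m\<close> enter level \<open>m\<close>.
\<close>

fun xseq yseq :: "real \<Rightarrow> real \<Rightarrow> real \<Rightarrow> real \<Rightarrow> (nat \<Rightarrow> real) \<Rightarrow> nat \<Rightarrow> nat \<Rightarrow> real"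
where
  "xseq a b c d k 0 i = 0"
| "xseq a b c d k (Suc 0) i = (if i = 1 then a + k 1 else b + k 1)"
| "xseq a b c d k (Suc (Suc m)) i =
     (if i \<le> 2 ^ Suc m then xseq a b c d k (Suc m) i
      else yseq a b c d k (Suc m) (i - 2 ^ Suc m) + k (Suc (Suc m)))"
| "yseq a b c d k 0 i = 0"
| "yseq a b c d k (Suc 0) i = (if i = 1 then c + k 1 else d + k 1)"
| "yseq a b c d k (Suc (Suc m)) i =
     (if i \<le> 2 ^ Suc m then yseq a b c d k (Suc m) i
      else xseq a b c d k (Suc m) (i - 2 ^ Suc m) + k (Suc (Suc m)))"

lemma seq_base:
  "xseq a b c d k 1 1 = a + k 1" "xseq a b c d k 1 2 = b + k 1"
  "yseq a b c d k 1 1 = c + k 1" "yseq a b c d k 1 2 = d + k 1"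
  by simp_all

lemma seq_step:
  assumes "2 \<le> m" "1 \<le> j" "j \<le> 2 ^ (m - 1)"
  shows "xseq a b c d k m j = xseq a b c d k (m - 1) j"
    and "xseq a b c d k m (2 ^ (m - 1) + j) = yseq a b c d k (m - 1) j + k m"
    and "yseq a b c d k m j = yseq a b c d k (m - 1) j"
    and "yseq a b c d k m (2 ^ (m - 1) + j) = xseq a b c d k (m - 1) j + k m"
proof -
  obtain r where r: "m = Suc (Suc r)"
    using assms(1) by (metis One_nat_def Suc_1 Suc_le_D Suc_le_mono)
  show "xseq a b c d k m j = xseq a b c d k (m - 1) j"
    and "xseq a b c d k m (2 ^ (m - 1) + j) = yseq a b c d k (m - 1) j + k m"
    and "yseq a b c d k m j = yseq a b c d k (m - 1) j"
    and "yseq a b c d k m (2 ^ (m - 1) + j) = xseq a b c d k (m - 1) j + k m"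
    using assms(2,3) by (simp_all add: r)
qed

end

theory Submission
  imports Defs
begin

text \<open>
  Expanding \<open>(y + t) ^ p - (x + t) ^ p\<close> by the binomial theorem shows that translating two sequences
  with equal power sums of all orders below \<open>p\<close> does not change the difference of their \<open>p\<close>-th power
  sums. Passing from level \<open>m\<close> to \<open>m + 1\<close> appends the translated sequences with the roles of
  \<open>x\<close> and \<open>y\<close> exchanged, so the two differences of \<open>(m + 1)\<close>-st power sums cancel; thus every level
  gains one order of equality.
\<close>

lemma power_sum_diff_translate:
  fixes f g :: "'a \<Rightarrow> 'b::comm_ring_1"
  assumes "\<And>q. q < p \<Longrightarrow> (\<Sum>i\<in>A. f i ^ q) = (\<Sum>i\<in>A. g i ^ q)"
  shows "(\<Sum>i\<in>A. (f i + t) ^ p) - (\<Sum>i\<in>A. (g i + t) ^ p) = (\<Sum>i\<in>A. f i ^ p) - (\<Sum>i\<in>A. g i ^ p)"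
proof -
  \<comment> \<open>Only the term \<open>q = p\<close> is split off; the others see \<open>h\<close>
    solely through its power sums of orders below \<open>p\<close>, where \<open>f\<close> and
    \<open>g\<close> agree.\<close>
  have expand: "(\<Sum>i\<in>A. (h i + t) ^ p) =
      (\<Sum>i\<in>A. h i ^ p) + (\<Sum>q<p. of_nat (p choose q) * t ^ (p - q) * (\<Sum>i\<in>A. h i ^ q))"
    for h :: "'a \<Rightarrow> 'b"
  proof -
    have "(\<Sum>i\<in>A. (h i + t) ^ p) = (\<Sum>i\<in>A. \<Sum>q\<le>p. of_nat (p choose q) * h i ^ q * t ^ (p - q))"
      by (simp add: binomial_ring)
    also have "\<dots> = (\<Sum>q\<le>p. of_nat (p choose q) * t ^ (p - q) * (\<Sum>i\<in>A. h i ^ q))"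
      by (subst sum.swap) (simp add: sum_distrib_left mult_ac)
    finally show ?thesis
      by (simp add: lessThan_Suc_atMost [symmetric] add.commute)
  qed
  show ?thesis
    using assms by (simp add: expand)
qed

lemma sum_atLeast1_power2_Suc:
  fixes f :: "nat \<Rightarrow> 'a::comm_monoid_add"
  shows "(\<Sum>i = 1..2 ^ Suc m. f i) = (\<Sum>i = 1..2 ^ m. f i) + (\<Sum>i = 1..2 ^ m. f (2 ^ m + i))"
proof -
  have "(\<Sum>i = 1..2 ^ m + 2 ^ m. f i) = (\<Sum>i = 1..2 ^ m. f i) + (\<Sum>i = 2 ^ m + 1..2 ^ m + 2 ^ m. f i)"
    by (rule sum.ub_add_nat) simp
  moreover have "(\<Sum>i = 2 ^ m + 1..2 ^ m + 2 ^ m. f i) = (\<Sum>i = 1..2 ^ m. f (2 ^ m + i))"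
    using sum.shift_bounds_cl_nat_ivl [of f 1 "2 ^ m" "2 ^ m"] by (simp add: add.commute)
  ultimately show ?thesis
    by (simp add: mult_2)
qed

text \<open>Order \<open>0\<close> is included because translation at order \<open>p\<close> calls
  for equality at every smaller order. The level is \<open>Suc m\<close> since level
  \<open>0\<close> is a dummy.\<close>

lemma power_sum_xseq_eq_yseq:
  assumes "a + b = c + d" "p \<le> Suc m"
  shows "(\<Sum>i = 1..2 ^ Suc m. xseq a b c d k (Suc m) i ^ p) =
         (\<Sum>i = 1..2 ^ Suc m. yseq a b c d k (Suc m) i ^ p)"
  using assms(2)
proof (induction m arbitrary: p)
  case 0
  then have "p = 0 \<or> p = 1"
    by auto
  with assms(1) show ?case
    by (auto simp: numeral_2_eq_2)
next
  case (Suc m)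
  let ?x = "xseq a b c d k (Suc m)" and ?y = "yseq a b c d k (Suc m)" and ?t = "k (Suc (Suc m))"
  let ?I = "{1..2 ^ Suc m} :: nat set"
  \<comment> \<open>Every \<open>q < p\<close> satisfies \<open>q \<le> Suc m\<close>, so the
    induction hypothesis covers it, although \<open>p\<close> itself may be
    \<open>Suc (Suc m)\<close>.\<close>
  have "(\<Sum>i\<in>?I. (?x i + ?t) ^ p) - (\<Sum>i\<in>?I. (?y i + ?t) ^ p) = (\<Sum>i\<in>?I. ?x i ^ p) - (\<Sum>i\<in>?I. ?y i ^ p)"
    using Suc by (intro power_sum_diff_translate) auto
  moreover have "(\<Sum>i = 1..2 ^ Suc (Suc m). xseq a b c d k (Suc (Suc m)) i ^ p) =
      (\<Sum>i\<in>?I. ?x i ^ p) + (\<Sum>i\<in>?I. (?y i + ?t) ^ p)"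
    by (subst sum_atLeast1_power2_Suc, intro arg_cong2 [where f = "(+)"] sum.cong) auto
  moreover have "(\<Sum>i = 1..2 ^ Suc (Suc m). yseq a b c d k (Suc (Suc m)) i ^ p) =
      (\<Sum>i\<in>?I. ?y i ^ p) + (\<Sum>i\<in>?I. (?x i + ?t) ^ p)"
    by (subst sum_atLeast1_power2_Suc, intro arg_cong2 [where f = "(+)"] sum.cong) auto
  ultimately show ?case
    by linarith
qed

text \<open>Each level copies the previous one as its first half. This turns the sums over the first
  \<open>2 ^ p\<close> entries at level \<open>n\<close> into the full sums at level
  \<open>p\<close>.\<close>

lemma seq_prefix:
  assumes "Suc m \<le> n" "i \<le> 2 ^ Suc m"
  shows "xseq a b c d k n i = xseq a b c d k (Suc m) i \<and> yseq a b c d k n i = yseq a b c d k (Suc m) i"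
  using assms(1)
proof (induction n rule: dec_induct)
  case (step n)
  then obtain r where r: "n = Suc r"
    by (cases n) auto
  \<comment> \<open>This puts \<open>i\<close> in the copying branch of the recursion for level
    \<open>Suc n\<close>.\<close>
  have "(2::nat) ^ Suc m \<le> 2 ^ n"
    using step.hyps by (intro power_increasing) auto
  with assms(2) have "i \<le> 2 ^ Suc r"
    unfolding r by (rule order_trans)
  with step.IH r show ?case
    by simp
qed simp

theorem theorem2:
  fixes a b c d :: real and k :: "nat \<Rightarrow> real" and n p :: nat
  assumes "a + b = c + d"
    and "1 \<le> n"
    and "1 \<le> p" and "p \<le> n"
  shows
   "(\<Sum>i = 1..2 ^ n. xseq a b c d k n i ^ p) = (\<Sum>i = 1..2 ^ n. yseq a b c d k n i ^ p) \<and>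
    (\<Sum>i = 1..2 ^ p. xseq a b c d k n i ^ p) = (\<Sum>i = 1..2 ^ p. yseq a b c d k n i ^ p)"
proof
  obtain m where "n = Suc m"
    using assms(2) by (cases n) auto
  then show "(\<Sum>i = 1..2 ^ n. xseq a b c d k n i ^ p) = (\<Sum>i = 1..2 ^ n. yseq a b c d k n i ^ p)"
    using power_sum_xseq_eq_yseq assms(1,4) by blast
next
  obtain q where q: "p = Suc q"
    using assms(3) by (cases p) auto
  have "xseq a b c d k n i = xseq a b c d k p i" "yseq a b c d k n i = yseq a b c d k p i"
    if "i \<in> {1..2 ^ p}" for i
    using seq_prefix [of q n i] assms(4) that q by auto
  then show "(\<Sum>i = 1..2 ^ p. xseq a b c d k n i ^ p) = (\<Sum>i = 1..2 ^ p. yseq a b c d k n i ^ p)"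
    using power_sum_xseq_eq_yseq [OF assms(1), of p q k] q by simp
qed

end
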